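(* For every integer $t\geq 1$, $$\delta_{t,1}(G_{\infty}) = \frac{1}{2t^2 - 2t + 1}.$$
   Context: $G_\infty$ denotes the infinite grid: the graph with vertex set $\mathbb{Z}\times\mathbb{Z}$ in which two vertices are adjacent if and only if they are at Euclidean distance $1$. $dist(\cdot,\cdot)$ is the graph distance (so $dist((a,b),(c,d))=|a-c|+|b-d|$). Let $t,r$ be positive integers. For a set of vertices $\mathbb{T}\subseteq \mathbb{Z}\times\mathbb{Z}$ (whose elements are called towers, of signal strength $t$), the signal a vertex $v$ receives from a tower $T\in\mathbb{T}$ is $sig(v,T)=\min(\max(t-dist(v,T),0),r)$, and the total signal at $v$ is $sig(v)=\sum_{T\in\mathbb{T}} sig(v,T)$. The set $\mathbb{T}$ is a $(t,r)$ broadcast on $G_\infty$ if $sig(v)\geq r$ for every vertex $v$. (Omitting the truncation at $r$ in the definition of signal gives the same notion of broadcast.) The broadcast density of $\mathbb{T}$ is $\lim_{n\to\infty} \frac{|\mathbb{T}\cap V_n|}{|V_n|}$, where $V_n=\{-n,\dots,n\}\times\{-n,\dots,n\}$. The optimal density $\delta_{t,r}(G_\infty)$ is the minimum broadcast density over all $(t,r)$ broadcasts on $G_\infty$ (among those for which the limit exists). *)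

theory Defs
  imports "HOL-Analysis.Analysis"
begin

type_synonym vertex = "int \<times> int"

definition grid_edges :: "vertex rel" where
  "grid_edges = {((a, b), (c, d)).
     dist (real_of_int a, real_of_int b) (real_of_int c, real_of_int d) = 1}"

(* A walk of length n from u to v is an element of the n-th relational power of the edge
   relation. The grid is connected, so the minimum exists; see grid_dist_eq below. *)
definition grid_dist :: "vertex \<Rightarrow> vertex \<Rightarrow> nat" where
  "grid_dist u v = (LEAST n. (u, v) \<in> grid_edges ^^ n)"

definition tower_signal :: "nat \<Rightarrow> nat \<Rightarrow> vertex \<Rightarrow> vertex \<Rightarrow> int" where
  "tower_signal t r v T = min (max (int t - int (grid_dist v T)) 0) (int r)"

(* Tower sets may be infinite, hence infsum. Only the finitely many towers at distance less
   than t contribute; see finite_tower_signal_support and total_signal_eq_sum below. *)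
definition total_signal :: "nat \<Rightarrow> nat \<Rightarrow> vertex set \<Rightarrow> vertex \<Rightarrow> real" where
  "total_signal t r \<T> v = (\<Sum>\<^sub>\<infinity>T\<in>\<T>. real_of_int (tower_signal t r v T))"

definition broadcast :: "nat \<Rightarrow> nat \<Rightarrow> vertex set \<Rightarrow> bool" where
  "broadcast t r \<T> \<longleftrightarrow> (\<forall>v. total_signal t r \<T> v \<ge> real r)"

definition grid_box :: "nat \<Rightarrow> vertex set" where
  "grid_box n = {- int n..int n} \<times> {- int n..int n}"

definition has_broadcast_density :: "vertex set \<Rightarrow> real \<Rightarrow> bool" where
  "has_broadcast_density \<T> \<delta> \<longleftrightarrow>
     (\<lambda>n. real (card (\<T> \<inter> grid_box n)) / real (card (grid_box n))) \<longlonglongrightarrow> \<delta>"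

(* The optimal density is a minimum over the broadcasts possessing a density, so it must be
   attained. It is stated as a relation because a minimum need not exist a priori. *)
definition is_optimal_density :: "nat \<Rightarrow> nat \<Rightarrow> real \<Rightarrow> bool" where
  "is_optimal_density t r \<delta> \<longleftrightarrow>
     (\<exists>\<T>. broadcast t r \<T> \<and> has_broadcast_density \<T> \<delta>) \<and>
     (\<forall>\<T> \<delta>'. broadcast t r \<T> \<longrightarrow> has_broadcast_density \<T> \<delta>' \<longrightarrow> \<delta> \<le> \<delta>')"

lemma is_optimal_density_unique:
  assumes "is_optimal_density t r \<delta>" "is_optimal_density t r \<delta>'"
  shows "\<delta> = \<delta>'"
  using assms unfolding is_optimal_density_def by (meson order_antisym)

lemma sum_squares_eq_1_iff:
  fixes x y :: int
  shows "x\<^sup>2 + y\<^sup>2 = 1 \<longleftrightarrow> \<bar>x\<bar> + \<bar>y\<bar> = 1"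
proof
  have le: "\<bar>z\<bar> \<le> z\<^sup>2" for z :: int
    using mult_left_mono[of 1 "\<bar>z\<bar>" "\<bar>z\<bar>"]
    by (cases "z = 0") (auto simp: power2_eq_square)
  assume *: "x\<^sup>2 + y\<^sup>2 = 1"
  then have "x \<noteq> 0 \<or> y \<noteq> 0" by auto
  with * le[of x] le[of y] show "\<bar>x\<bar> + \<bar>y\<bar> = 1" by linarith
next
  assume "\<bar>x\<bar> + \<bar>y\<bar> = 1"
  then have "(x = 0 \<and> (y = 1 \<or> y = -1)) \<or> (y = 0 \<and> (x = 1 \<or> x = -1))"
    by linarith
  then show "x\<^sup>2 + y\<^sup>2 = 1" by auto
qed

lemma grid_edges_iff:
  "((a, b), (c, d)) \<in> grid_edges \<longleftrightarrow> \<bar>a - c\<bar> + \<bar>b - d\<bar> = 1"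
proof -
  have "((a, b), (c, d)) \<in> grid_edges \<longleftrightarrow>
      (real_of_int (a - c))\<^sup>2 + (real_of_int (b - d))\<^sup>2 = 1"
    by (simp add: grid_edges_def dist_Pair_Pair dist_real_def)
  also have "\<dots> \<longleftrightarrow> (a - c)\<^sup>2 + (b - d)\<^sup>2 = 1"
    by (simp only: of_int_power[symmetric] of_int_add[symmetric] of_int_eq_1_iff)
  also have "\<dots> \<longleftrightarrow> \<bar>a - c\<bar> + \<bar>b - d\<bar> = 1"
    by (rule sum_squares_eq_1_iff)
  finally show ?thesis .
qed

lemma grid_walk_length:
  "((a, b), (c, d)) \<in> grid_edges ^^ n \<Longrightarrow> \<bar>a - c\<bar> + \<bar>b - d\<bar> \<le> int n"
proof (induction n arbitrary: c d)
  case (Suc n)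
  then obtain x y where "((a, b), (x, y)) \<in> grid_edges ^^ n" "((x, y), (c, d)) \<in> grid_edges"
    by auto
  with Suc.IH[of x y] show ?case by (auto simp: grid_edges_iff)
qed auto

lemma grid_walk_exists:
  "\<bar>a - c\<bar> + \<bar>b - d\<bar> = int n \<Longrightarrow> ((a, b), (c, d)) \<in> grid_edges ^^ n"
proof (induction n arbitrary: c d)
  case (Suc n)
  define x where "x = (if c = a then c else if c < a then c + 1 else c - 1)"
  define y where "y = (if c \<noteq> a then d else if d < b then d + 1 else d - 1)"
  have "\<bar>a - x\<bar> + \<bar>b - y\<bar> = int n" "\<bar>x - c\<bar> + \<bar>y - d\<bar> = 1"
    using Suc.prems by (auto simp: x_def y_def)
  then show ?case
    using Suc.IH[of x y] by (auto simp: grid_edges_iff)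
qed auto

lemma grid_dist_eq: "int (grid_dist (a, b) (c, d)) = \<bar>a - c\<bar> + \<bar>b - d\<bar>"
proof -
  have "grid_dist (a, b) (c, d) = nat (\<bar>a - c\<bar> + \<bar>b - d\<bar>)"
    unfolding grid_dist_def
    by (rule Least_equality) (use grid_walk_exists grid_walk_length in fastforce)+
  then show ?thesis by simp
qed

lemma finite_tower_signal_support: "finite {T. tower_signal t r v T \<noteq> 0}"
proof -
  obtain a b where v: "v = (a, b)" by force
  have "{T. tower_signal t r v T \<noteq> 0} \<subseteq> {a - int t..a + int t} \<times> {b - int t..b + int t}"
    by (auto simp: v tower_signal_def grid_dist_eq)
  then show ?thesis by (rule finite_subset) auto
qed

lemma total_signal_eq_sum:
  "total_signal t r \<T> v =
     real_of_int (\<Sum>T\<in>{T \<in> \<T>. tower_signal t r v T \<noteq> 0}. tower_signal t r v T)"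
proof -
  have "finite {T \<in> \<T>. tower_signal t r v T \<noteq> 0}"
    by (rule finite_subset[OF _ finite_tower_signal_support[of t r v]]) auto
  moreover have "total_signal t r \<T> v =
      infsum (\<lambda>T. real_of_int (tower_signal t r v T)) {T \<in> \<T>. tower_signal t r v T \<noteq> 0}"
    unfolding total_signal_def by (rule infsum_cong_neutral) auto
  ultimately show ?thesis by simp
qed

end

theory Submission
  imports Defs "HOL-Real_Asymp.Real_Asymp"
begin

text \<open>
  For \<open>r = 1\<close> a tower contributes signal \<open>1\<close> exactly to the vertices of the closed ball of radius
  \<open>t - 1\<close> around it, so a broadcast is a covering of the grid by such balls. Write \<open>s = t - 1\<close>; the
  ball has \<open>D = 2 s\<^sup>2 + 2 s + 1 = 2 t\<^sup>2 - 2 t + 1\<close> elements.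

  Lower bound: the towers within the box of radius \<open>n + s\<close> must cover the box of radius \<open>n\<close>, so there
  are at least \<open>(2 n + 1)\<^sup>2 / D\<close> of them (\<open>card_grid_box_le_covering\<close>), and dividing by the number of
  vertices of the box yields density at least \<open>1 / D\<close>.

  Attainment: the ball tiles the grid by translations. The linear form
  \<open>\<phi> (x, y) = s (x + y) + y\<close> maps the ball bijectively onto the \<open>D\<close> consecutive integers
  \<open>-(s\<^sup>2 + s), \<dots>, s\<^sup>2 + s\<close> (\<open>bij_betw_lee_form\<close>), which form a complete system of residues
  modulo \<open>D\<close>. Hence every vertex is uniquely the sum of a point of the ball and a point of the lattice
  \<open>{v. D dvd \<phi> v}\<close>. Existence says that the lattice is a broadcast; uniqueness bounds the number of its
  points in a box from above (\<open>lee_lattice_packing\<close>), and together with the lower bound this gives it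
  density \<open>1 / D\<close>.
\<close>

section \<open>Balls of the grid\<close>

text \<open>The ball of radius \<open>s\<close> around the origin for the graph distance.\<close>

definition grid_ball :: "nat \<Rightarrow> vertex set" where
  "grid_ball s = {(x, y). \<bar>x\<bar> + \<bar>y\<bar> \<le> int s}"

text \<open>The number of elements of \<^term>\<open>grid_ball s\<close>, as an integer because it serves as a modulus.\<close>

definition ball_size :: "nat \<Rightarrow> int" where
  "ball_size s = 2 * (int s)\<^sup>2 + 2 * int s + 1"

text \<open>The linear form whose values enumerate the ball of radius \<open>s\<close> diagonal by diagonal; modulo
  \<^term>\<open>ball_size s\<close> it is the syndrome of the perfect Lee code of radius \<open>s\<close> in the plane.\<close>

definition lee_form :: "nat \<Rightarrow> vertex \<Rightarrow> int" where
  "lee_form s v = int s * (fst v + snd v) + snd v"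

lemma ball_size_pos: "ball_size s > 0"
  by (simp add: ball_size_def add_nonneg_pos)

lemma lee_form_add: "lee_form s (u + v) = lee_form s u + lee_form s v"
  by (simp add: lee_form_def algebra_simps)

lemma lee_form_diff: "lee_form s (u - v) = lee_form s u - lee_form s v"
  by (simp add: lee_form_def algebra_simps)

lemma abs_lee_form_le:
  assumes "b \<in> grid_ball s"
  shows "\<bar>lee_form s b\<bar> \<le> (int s)\<^sup>2 + int s"
proof -
  obtain x y where b: "b = (x, y)" by force
  have xy: "\<bar>x + y\<bar> \<le> int s" "\<bar>y\<bar> \<le> int s"
    using assms by (auto simp: b grid_ball_def)
  have "\<bar>lee_form s b\<bar> \<le> int s * \<bar>x + y\<bar> + \<bar>y\<bar>"
    unfolding lee_form_def b fst_conv snd_conv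
    by (rule order_trans[OF abs_triangle_ineq]) (simp add: abs_mult)
  also have "\<dots> \<le> int s * int s + int s"
    by (intro add_mono mult_left_mono xy) auto
  finally show ?thesis by (simp add: power2_eq_square)
qed

lemma inj_on_lee_form: "inj_on (lee_form s) (grid_ball s)"
proof (rule inj_onI, clarify)
  fix x y x' y'
  assume ball: "(x, y) \<in> grid_ball s" "(x', y') \<in> grid_ball s"
    and eq: "lee_form s (x, y) = lee_form s (x', y')"
  define k where "k = (x - x') + (y - y')"
  \<comment> \<open>The kernel of the form is generated by \<open>(s + 1, -s)\<close>, whose norm \<open>2 s + 1\<close> exceeds the
    diameter of the ball.\<close>
  have dy: "y - y' = - (int s * k)"
    using eq by (simp add: lee_form_def k_def algebra_simps)
  have dx: "x - x' = (int s + 1) * k"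
    using dy by (simp add: k_def algebra_simps)
  have "(2 * int s + 1) * \<bar>k\<bar> = \<bar>x - x'\<bar> + \<bar>y - y'\<bar>"
    unfolding dx dy abs_minus_cancel abs_mult by (simp add: algebra_simps)
  also have "\<dots> \<le> 2 * int s"
    using ball by (auto simp: grid_ball_def)
  finally have "(2 * int s + 1) * \<bar>k\<bar> < (2 * int s + 1) * 1" by simp
  then have "k = 0"
    by (subst (asm) mult_less_cancel_left_pos) auto
  then show "x = x' \<and> y = y'" using dx dy by simp
qed

lemma lee_form_surj:
  assumes "\<bar>m\<bar> \<le> (int s)\<^sup>2 + int s"
  obtains b where "b \<in> grid_ball s" "lee_form s b = m"
proof -
  \<comment> \<open>On a diagonal \<open>x + y = c\<close> with \<open>\<bar>c\<bar> \<le> s\<close> the ball has \<open>s + 1\<close> points if \<open>c - s\<close> is even and \<open>s\<close> points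
    otherwise, and the form takes consecutive values on them. The resulting intervals of the two kinds
    alternate, so the position of \<open>m\<close> is found by division by \<open>2 s + 1\<close>.\<close>
  define i where "i = (m + (int s)\<^sup>2 + int s) div (2 * int s + 1)"
  define j where "j = (m + (int s)\<^sup>2 + int s) mod (2 * int s + 1)"
  have m: "m = (2 * int s + 1) * i + j - (int s)\<^sup>2 - int s"
    using mult_div_mod_eq[of "2 * int s + 1" "m + (int s)\<^sup>2 + int s"]
    by (simp add: i_def j_def)
  have j: "0 \<le> j" "j \<le> 2 * int s"
    using pos_mod_bound[of "2 * int s + 1" "m + (int s)\<^sup>2 + int s"] by (auto simp: j_def)
  have i0: "0 \<le> i"
    using assms by (auto simp: i_def intro!: pos_imp_zdiv_nonneg_iff[THEN iffD2])
  have le: "(2 * int s + 1) * i + j \<le> (2 * int s + 1) * int s + int s"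
    using assms m by (simp add: power2_eq_square algebra_simps)
  show thesis
  proof (cases "j \<le> int s")
    case True
    have "(2 * int s + 1) * i < (2 * int s + 1) * (int s + 1)"
      using le j(1) by (simp add: algebra_simps)
    then have "i \<le> int s" by (subst (asm) mult_less_cancel_left_pos) auto
    with i0 True j have "(i - j, i + j - int s) \<in> grid_ball s"
      by (auto simp: grid_ball_def)
    moreover have "lee_form s (i - j, i + j - int s) = m"
      by (simp add: m lee_form_def power2_eq_square algebra_simps)
    ultimately show thesis using that by blast
  next
    case False
    define j' where "j' = j - int s - 1"
    have "(2 * int s + 1) * i < (2 * int s + 1) * int s"
      using le False by (simp add: algebra_simps)
    then have "i < int s" by (subst (asm) mult_less_cancel_left_pos) auto
    with i0 False j have "(i - j', i + j' + 1 - int s) \<in> grid_ball s"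
      by (auto simp: grid_ball_def j'_def)
    moreover have "lee_form s (i - j', i + j' + 1 - int s) = m"
      by (simp add: m j'_def lee_form_def power2_eq_square algebra_simps)
    ultimately show thesis using that by blast
  qed
qed

lemma bij_betw_lee_form:
  "bij_betw (lee_form s) (grid_ball s) {- ((int s)\<^sup>2 + int s)..(int s)\<^sup>2 + int s}"
proof -
  have "lee_form s ` grid_ball s = {- ((int s)\<^sup>2 + int s)..(int s)\<^sup>2 + int s}"
  proof (intro equalityI subsetI)
    fix m assume "m \<in> lee_form s ` grid_ball s"
    then show "m \<in> {- ((int s)\<^sup>2 + int s)..(int s)\<^sup>2 + int s}"
      using abs_lee_form_le by fastforce
  next
    fix m assume "m \<in> {- ((int s)\<^sup>2 + int s)..(int s)\<^sup>2 + int s}"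
    then have "\<bar>m\<bar> \<le> (int s)\<^sup>2 + int s" by auto
    then show "m \<in> lee_form s ` grid_ball s"
      using lee_form_surj by (metis imageI)
  qed
  then show ?thesis using inj_on_lee_form by (simp add: bij_betw_def)
qed

lemma finite_grid_ball: "finite (grid_ball s)"
  using bij_betw_finite[OF bij_betw_lee_form] by simp

lemma card_grid_ball: "int (card (grid_ball s)) = ball_size s"
  using bij_betw_same_card[OF bij_betw_lee_form, of s] by (simp add: ball_size_def)

lemma broadcast_iff_covering:
  "broadcast (Suc s) 1 \<T> \<longleftrightarrow> (\<forall>v. \<exists>T\<in>\<T>. v - T \<in> grid_ball s)"
proof -
  have sig: "tower_signal (Suc s) 1 v T = (if v - T \<in> grid_ball s then 1 else 0)" for v T
    by (cases v; cases T) (auto simp: tower_signal_def grid_dist_eq grid_ball_def)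
  have "total_signal (Suc s) 1 \<T> v \<ge> 1 \<longleftrightarrow> (\<exists>T\<in>\<T>. v - T \<in> grid_ball s)" for v
  proof -
    let ?A = "{T \<in> \<T>. v - T \<in> grid_ball s}"
    have eq: "{T \<in> \<T>. tower_signal (Suc s) 1 v T \<noteq> 0} = ?A" by (auto simp: sig simp del: One_nat_def)
    have "finite ?A"
      by (rule finite_subset[OF _ finite_tower_signal_support[of "Suc s" 1 v]])
        (auto simp: sig simp del: One_nat_def)
    moreover have "total_signal (Suc s) 1 \<T> v = real (card ?A)"
      unfolding total_signal_eq_sum eq by (simp add: sig del: One_nat_def)
    ultimately show ?thesis
      using card_gt_0_iff[of ?A] by (auto simp: Suc_le_eq)
  qed
  then show ?thesis by (simp add: broadcast_def)
qed

section \<open>Counting towers in boxes\<close>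

lemma finite_grid_box: "finite (grid_box n)"
  by (simp add: grid_box_def)

lemma card_grid_box: "card (grid_box n) = (2 * n + 1)\<^sup>2"
proof -
  have "nat (int n + 1 + int n) = 2 * n + 1" by linarith
  then show ?thesis by (simp add: grid_box_def card_cartesian_product power2_eq_square)
qed

text \<open>Points of the box of radius \<open>n\<close> are covered only from the box of radius \<open>n + s\<close>.\<close>

lemma card_grid_box_le_covering:
  assumes "\<And>v. \<exists>T\<in>\<T>. v - T \<in> grid_ball s"
  shows "int ((2 * n + 1)\<^sup>2) \<le> ball_size s * int (card (\<T> \<inter> grid_box (n + s)))"
proof -
  let ?P = "(\<T> \<inter> grid_box (n + s)) \<times> grid_ball s"
  have fin: "finite ?P" using finite_grid_box finite_grid_ball by blast
  have "grid_box n \<subseteq> (\<lambda>(T, b). T + b) ` ?P"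
  proof
    fix v assume v: "v \<in> grid_box n"
    obtain T where T: "T \<in> \<T>" "v - T \<in> grid_ball s" using assms by blast
    have "T \<in> grid_box (n + s)"
      using v T(2) by (cases v; cases T) (auto simp: grid_box_def grid_ball_def)
    then show "v \<in> (\<lambda>(T, b). T + b) ` ?P"
      using T by (intro image_eqI[of _ _ "(T, v - T)"]) auto
  qed
  then have "card (grid_box n) \<le> card ?P"
    using surj_card_le fin by blast
  then have "int (card (grid_box n)) \<le> int (card (\<T> \<inter> grid_box (n + s))) * int (card (grid_ball s))"
    by (simp add: card_cartesian_product flip: of_nat_mult)
  then show ?thesis by (simp add: card_grid_box card_grid_ball mult.commute)
qed

lemma covering_density_ge:
  assumes "\<And>v. \<exists>T\<in>\<T>. v - T \<in> grid_ball s" and "n \<ge> s"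
  shows "(2 * (real n - real s) + 1)\<^sup>2 / (2 * real n + 1)\<^sup>2 / real_of_int (ball_size s)
    \<le> real (card (\<T> \<inter> grid_box n)) / real (card (grid_box n))"
proof -
  have "int ((2 * (n - s) + 1)\<^sup>2) \<le> ball_size s * int (card (\<T> \<inter> grid_box n))"
    using card_grid_box_le_covering[OF assms(1), of "n - s"] assms(2) by simp
  then have "real_of_int (int ((2 * (n - s) + 1)\<^sup>2))
      \<le> real_of_int (ball_size s * int (card (\<T> \<inter> grid_box n)))"
    by (simp only: of_int_le_iff)
  then have "(2 * (real n - real s) + 1)\<^sup>2 \<le> real_of_int (ball_size s) * real (card (\<T> \<inter> grid_box n))"
    using assms(2) by (simp add: of_nat_diff add.commute)
  then have "(2 * (real n - real s) + 1)\<^sup>2 / real_of_int (ball_size s) \<le> real (card (\<T> \<inter> grid_box n))"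
    using ball_size_pos[of s] by (simp add: divide_le_eq mult.commute)
  then have "(2 * (real n - real s) + 1)\<^sup>2 / real_of_int (ball_size s) / (2 * real n + 1)\<^sup>2
      \<le> real (card (\<T> \<inter> grid_box n)) / (2 * real n + 1)\<^sup>2"
    by (rule divide_right_mono) simp
  then show ?thesis by (simp add: card_grid_box mult.commute add.commute)
qed

section \<open>The perfect lattice covering\<close>

text \<open>The periodic extension of the perfect Lee code of radius \<open>s\<close>: the kernel of \<^term>\<open>lee_form s\<close>
  modulo \<^term>\<open>ball_size s\<close>.\<close>

definition lee_lattice :: "nat \<Rightarrow> vertex set" where
  "lee_lattice s = {v. ball_size s dvd lee_form s v}"

lemma lee_lattice_covering: "\<exists>T\<in>lee_lattice s. v - T \<in> grid_ball s"
proof -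
  \<comment> \<open>the representative of \<^term>\<open>lee_form s v\<close> modulo \<^term>\<open>ball_size s\<close> of least absolute value\<close>
  define h where "h = (int s)\<^sup>2 + int s"
  define m where "m = (lee_form s v + h) mod ball_size s - h"
  have D: "ball_size s = 2 * h + 1" by (simp add: ball_size_def h_def)
  have "0 \<le> (lee_form s v + h) mod ball_size s" "(lee_form s v + h) mod ball_size s < 2 * h + 1"
    using ball_size_pos[of s] pos_mod_bound[of "ball_size s" "lee_form s v + h"] by (auto simp: D)
  then have "\<bar>m\<bar> \<le> (int s)\<^sup>2 + int s" unfolding m_def h_def[symmetric] by linarith
  then obtain b where b: "b \<in> grid_ball s" "lee_form s b = m" by (rule lee_form_surj)
  have "lee_form s (v - b) = (lee_form s v + h) - (lee_form s v + h) mod ball_size s"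
    by (simp add: lee_form_diff b m_def)
  then have "v - b \<in> lee_lattice s"
    by (simp add: lee_lattice_def dvd_minus_mod)
  with b(1) show ?thesis by (intro bexI[of _ "v - b"]) auto
qed

text \<open>The following bound holds because the translates of the ball by lattice points are
  pairwise disjoint, and those centred in the box of radius \<open>n\<close> lie in the box of radius \<open>n + s\<close>.\<close>

lemma lee_lattice_packing:
  "ball_size s * int (card (lee_lattice s \<inter> grid_box n)) \<le> int ((2 * (n + s) + 1)\<^sup>2)"
proof -
  let ?P = "(lee_lattice s \<inter> grid_box n) \<times> grid_ball s"
  have "inj_on (\<lambda>(T, b). T + b) ?P"
  proof (rule inj_onI, clarify)
    fix T b T' b'
    assume T: "T \<in> lee_lattice s" "T' \<in> lee_lattice s"
      and b: "b \<in> grid_ball s" "b' \<in> grid_ball s" and eq: "T + b = T' + b'"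
    have "lee_form s T + lee_form s b = lee_form s T' + lee_form s b'"
      using arg_cong[OF eq, of "lee_form s"] by (simp add: lee_form_add)
    then have "lee_form s b - lee_form s b' = lee_form s T' - lee_form s T" by simp
    then have dvd: "ball_size s dvd lee_form s b - lee_form s b'"
      using T by (simp add: lee_lattice_def)
    have "\<bar>lee_form s b - lee_form s b'\<bar> < ball_size s"
      using abs_lee_form_le[OF b(1)] abs_lee_form_le[OF b(2)] by (simp add: ball_size_def)
    with dvd have "lee_form s b - lee_form s b' = 0"
      using dvd_imp_le_int[of "lee_form s b - lee_form s b'" "ball_size s"] by fastforce
    then have "b = b'" using inj_on_lee_form b by (auto dest: inj_onD)
    with eq show "T = T' \<and> b = b'" by simp
  qed
  moreover have "(\<lambda>(T, b). T + b) ` ?P \<subseteq> grid_box (n + s)"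
    by (auto simp: grid_box_def grid_ball_def)
  ultimately have "card ?P \<le> card (grid_box (n + s))"
    using finite_grid_box by (rule card_inj_on_le)
  then have "int (card (lee_lattice s \<inter> grid_box n)) * int (card (grid_ball s))
      \<le> int (card (grid_box (n + s)))"
    by (simp add: card_cartesian_product flip: of_nat_mult)
  then show ?thesis by (simp add: card_grid_box card_grid_ball mult.commute)
qed

lemma lee_lattice_density_le:
  "real (card (lee_lattice s \<inter> grid_box n)) / real (card (grid_box n))
    \<le> (2 * (real n + real s) + 1)\<^sup>2 / (2 * real n + 1)\<^sup>2 / real_of_int (ball_size s)"
proof -
  have "real_of_int (ball_size s * int (card (lee_lattice s \<inter> grid_box n)))
      \<le> real_of_int (int ((2 * (n + s) + 1)\<^sup>2))"
    using lee_lattice_packing by (simp only: of_int_le_iff)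
  then have "real_of_int (ball_size s) * real (card (lee_lattice s \<inter> grid_box n))
      \<le> (2 * (real n + real s) + 1)\<^sup>2"
    by (simp add: add_ac)
  then have "real (card (lee_lattice s \<inter> grid_box n))
      \<le> (2 * (real n + real s) + 1)\<^sup>2 / real_of_int (ball_size s)"
    using ball_size_pos[of s] by (simp add: le_divide_eq mult.commute)
  then have "real (card (lee_lattice s \<inter> grid_box n)) / (2 * real n + 1)\<^sup>2
      \<le> (2 * (real n + real s) + 1)\<^sup>2 / real_of_int (ball_size s) / (2 * real n + 1)\<^sup>2"
    by (rule divide_right_mono) simp
  then show ?thesis by (simp add: card_grid_box mult.commute add.commute)
qed

section \<open>The optimal density\<close>

lemma box_ratio_tendsto:
  fixes c :: real
  shows "(\<lambda>n. (2 * (real n + c) + 1)\<^sup>2 / (2 * real n + 1)\<^sup>2 / D) \<longlonglongrightarrow> 1 / D"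
proof -
  have "(\<lambda>n. (2 * (real n + c) + 1)\<^sup>2 / (2 * real n + 1)\<^sup>2) \<longlonglongrightarrow> 1"
    by real_asymp
  from tendsto_mult_right[OF this, of "inverse D"] show ?thesis
    by (simp add: divide_inverse)
qed

theorem theorem1:
  fixes t :: nat
  assumes "t \<ge> 1"
  shows "is_optimal_density t 1 (1 / (2 * (real t)\<^sup>2 - 2 * real t + 1))"
proof -
  obtain s where t: "t = Suc s" using assms by (cases t) auto
  define D where "D = real_of_int (ball_size s)"
  have D: "2 * (real t)\<^sup>2 - 2 * real t + 1 = D"
    by (simp add: D_def t ball_size_def power2_eq_square algebra_simps)
  have lower: "(\<lambda>n. (2 * (real n - real s) + 1)\<^sup>2 / (2 * real n + 1)\<^sup>2 / D) \<longlonglongrightarrow> 1 / D"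
    using box_ratio_tendsto[of "- real s" D] by simp
  have upper: "(\<lambda>n. (2 * (real n + real s) + 1)\<^sup>2 / (2 * real n + 1)\<^sup>2 / D) \<longlonglongrightarrow> 1 / D"
    by (rule box_ratio_tendsto)
  have "broadcast t 1 (lee_lattice s)"
    unfolding t broadcast_iff_covering using lee_lattice_covering by blast
  moreover have "has_broadcast_density (lee_lattice s) (1 / D)"
    unfolding has_broadcast_density_def
  proof (rule tendsto_sandwich[OF _ _ lower upper])
    show "\<forall>\<^sub>F n in sequentially. (2 * (real n - real s) + 1)\<^sup>2 / (2 * real n + 1)\<^sup>2 / D
        \<le> real (card (lee_lattice s \<inter> grid_box n)) / real (card (grid_box n))"
      unfolding D_def eventually_sequentially
      using covering_density_ge[OF lee_lattice_covering] by blast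
    show "\<forall>\<^sub>F n in sequentially. real (card (lee_lattice s \<inter> grid_box n)) / real (card (grid_box n))
        \<le> (2 * (real n + real s) + 1)\<^sup>2 / (2 * real n + 1)\<^sup>2 / D"
      unfolding D_def using lee_lattice_density_le by (intro always_eventually) blast
  qed
  moreover have "1 / D \<le> \<delta>'"
    if "broadcast t 1 \<T>" "has_broadcast_density \<T> \<delta>'" for \<T> \<delta>'
  proof -
    have cover: "\<exists>T\<in>\<T>. v - T \<in> grid_ball s" for v
      using that(1) unfolding t broadcast_iff_covering by blast
    show ?thesis
      using lower that(2)[unfolded has_broadcast_density_def]
    proof (rule LIMSEQ_le)
      show "\<exists>N. \<forall>n\<ge>N. (2 * (real n - real s) + 1)\<^sup>2 / (2 * real n + 1)\<^sup>2 / D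
          \<le> real (card (\<T> \<inter> grid_box n)) / real (card (grid_box n))"
        unfolding D_def using covering_density_ge[OF cover] by blast
    qed
  qed
  ultimately show ?thesis unfolding D is_optimal_density_def by blast
qed

end
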